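(* Let $p$ be a prime with $p\ne2$ and let $1\le q<p$. The lens space $L(p,q)$ has non-trivial $p$-fold Massey products over $\mathbb Z_p=\mathbb Z/p\mathbb Z$: for every constant $c\in\mathbb Z_p-\{0\}$, $$\langle \underbrace{c\cdot x,\dots,c\cdot x}_{p}\rangle=\{c\cdot y\}\subseteq H=H^\bullet(L(p,q),\mathbb Z_p),$$ where $x\in H^1$ and $y\in H^2$ are the generators in the minimal $A_\infty$ model of $L(p,q)$ over $\mathbb Z_p$ described in the context, and the Massey product is taken in that $A_\infty$ algebra.
   Context: $A_\infty$ algebras over $R=\mathbb Z_p$. For a graded module $A$, $\underline A$ is $A$ shifted down by one, $|\underline a|=|a|-1$. An $A_\infty$ algebra has maps $\mu_k:A^{\otimes k}\to A$ ($k\ge1$) of degree $2-k$ whose shifts, $\underline{\mu_k}(\underline{a_1},\dots,\underline{a_k})=(-1)^{\sum_{i}(k-i)|\underline{a_i}|}\,\underline{\mu_k(a_1,\dots,a_k)}$ (of degree $1$), satisfy $\sum_{k+\ell-1=n}\sum_{i+j+1=k}\underline{\mu_k}\circ(id^{\otimes i}\otimes\underline{\mu_\ell}\otimes id^{\otimes j})=0$ for all $n\ge1$ (Koszul sign rule). $d=\mu_1$; the algebra is minimal if $\mu_1=0$ (then $H(A)=A$). Minimal model. $L(p,q)$ has a minimal $A_\infty$ model over $\mathbb Z_p$ (a minimal $A_\infty$ algebra structure on $H=H^\bullet(L(p,q),\mathbb Z_p)$, $A_\infty$ quasi-isomorphic to the cochain algebra of $L(p,q)$ over $\mathbb Z_p$)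 with basis $e,x,y,z$ of degrees $0,1,2,3$, whose only non-trivial products on generators are $\mu_2(e,e)=e$, $\mu_2(e,w)=\mu_2(w,e)=w$ for $w\in\{x,y,z\}$, $\mu_2(x,y)=\mu_2(y,x)=z$, and $\mu_p(x,\dots,x)=y$. Massey products. For $x_{1,1},\dots,x_{n,n}\in A$ ($n\ge3$), a defining system is a collection of homogeneous $x_{i,j}\in A$, $1\le i\le j\le n$, $(i,j)\ne(1,n)$, with the given diagonal entries, with $|\underline{x_{i,j}}|=|\underline{x_{i,i}}|+\dots+|\underline{x_{j,j}}|$, and $d(x_{i,j})=-\mathcal S^{i,j}$ for all $(i,j)\ne(1,n)$, where $\underline{\mathcal S^{i,j}}=\sum_{r\ge2}\ \sum_{i=j_0\le j_1<j_2<\dots<j_r=j}\underline{\mu_r}(\underline{x_{j_0,j_1}},\underline{x_{j_1+1,j_2}},\dots,\underline{x_{j_{r-1}+1,j_r}})$. The $n$-fold Massey product $\langle x_{1,1},\dots,x_{n,n}\rangle\subseteq H(A)$ is the set of classes $[\mathcal S^{1,n}]$ over all defining systems; it is trivial if it is empty or contains $0$. *)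

theory Defs
  imports
    "HOL-Analysis.Analysis"
    "HOL-Homology.Homology"
    "HOL-Library.Function_Algebras"
    "Berlekamp_Zassenhaus.Finite_Field"
begin

section \<open>Graded modules with operations\<close>

text \<open>
  \<open>part A d\<close> is the degree-\<open>d\<close> part of the graded module, and \<open>mu A [a1, ..., ak]\<close> is
  \<open>mu_k(a1, ..., ak)\<close>. A homogeneous tensor \<open>a1 \<otimes> ... \<otimes> ak\<close> is represented by
  the list of pairs \<open>(|ai|, ai)\<close>: the zero element has every degree, so degrees are carried along.
  Only the values of \<open>mu A\<close> on nonempty lists of homogeneous elements are meaningful.
\<close>

record ('k, 'a) graded_ops =
  smul :: "'k \<Rightarrow> 'a \<Rightarrow> 'a"
  part :: "int \<Rightarrow> 'a set"
  mu :: "'a list \<Rightarrow> 'a"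

definition graded_module :: "('k::comm_ring_1, 'a::ab_group_add) graded_ops \<Rightarrow> bool" where
  "graded_module A \<longleftrightarrow>
     Modules.module (smul A) \<and>
     (\<forall>d. Modules.module.subspace (smul A) (part A d)) \<and>
     (\<forall>D a. finite D \<and> (\<forall>d\<in>D. a d \<in> part A d) \<and> (\<Sum>d\<in>D. a d) = 0 \<longrightarrow> (\<forall>d\<in>D. a d = 0))"

definition homogeneous :: "('k, 'a) graded_ops \<Rightarrow> (int \<times> 'a) list \<Rightarrow> bool" where
  "homogeneous A ws \<longleftrightarrow> (\<forall>(d, a) \<in> set ws. a \<in> part A d)"

text \<open>A family of multilinear maps \<open>g_k\<close> (\<open>k \<ge> 1\<close>) from the \<open>k\<close>-fold tensor power of \<open>A\<close> to \<open>B\<close>, with \<open>g_k\<close> of degree \<open>D k\<close>.\<close>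

definition graded_multilinear ::
  "('k, 'a::ab_group_add) graded_ops \<Rightarrow> ('k, 'b::ab_group_add) graded_ops \<Rightarrow>
   (nat \<Rightarrow> int) \<Rightarrow> ('a list \<Rightarrow> 'b) \<Rightarrow> bool" where
  "graded_multilinear A B D g \<longleftrightarrow>
     (\<forall>ws. ws \<noteq> [] \<and> homogeneous A ws \<longrightarrow>
        g (map snd ws) \<in> part B (sum_list (map fst ws) + D (length ws))) \<and>
     (\<forall>us vs d a b. homogeneous A us \<and> homogeneous A vs \<and> a \<in> part A d \<and> b \<in> part A d \<longrightarrow>
        g (map snd us @ (a + b) # map snd vs)
          = g (map snd us @ a # map snd vs) + g (map snd us @ b # map snd vs)) \<and>
     (\<forall>us vs d a r. homogeneous A us \<and> homogeneous A vs \<and> a \<in> part A d \<longrightarrow>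
        g (map snd us @ smul A r a # map snd vs) = smul B r (g (map snd us @ a # map snd vs)))"


section \<open>\<open>A\<^sub>\<infinity>\<close> algebras\<close>

definition with_sign :: "int \<Rightarrow> 'a::ab_group_add \<Rightarrow> 'a" where
  "with_sign n a = (if even n then a else - a)"

text \<open>Total shifted degree, where the shifted degree of \<open>a\<close> is \<open>|a| - 1\<close>.\<close>

definition sdeg :: "(int \<times> 'a) list \<Rightarrow> int" where
  "sdeg ws = (\<Sum>(d, a) \<leftarrow> ws. d - 1)"

text \<open>
  The shift of an operation: its value on the shifts of \<open>a1, ..., ak\<close> is the shift of
  \<open>(-1)^(\<Sum>i. (k - i) (|ai| - 1)) g(a1, ..., ak)\<close>. List positions start at \<open>0\<close>, hence the \<open>Suc i\<close>.
\<close>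

definition shifted :: "('a list \<Rightarrow> 'b::ab_group_add) \<Rightarrow> (int \<times> 'a) list \<Rightarrow> 'b" where
  "shifted g ws =
     with_sign (\<Sum>i<length ws. (int (length ws) - int (Suc i)) * (fst (ws ! i) - 1)) (g (map snd ws))"

text \<open>
  The left-hand side of the \<open>A\<^sub>\<infinity>\<close> relation, with an arbitrary outer operation \<open>g\<close>:
  the sum of \<open>g \<circ> (id \<otimes> mu \<otimes> id)\<close> over all positions of the inner operation, all operations
  shifted. The shifted inner operation has degree \<open>1\<close>, so the Koszul rule contributes the total
  shifted degree of the inputs to its left, and its value has unshifted degree \<open>sdeg vs + 2\<close>.
\<close>

definition insert_mu ::
  "('k, 'a::ab_group_add) graded_ops \<Rightarrow> ('a list \<Rightarrow> 'b::ab_group_add) \<Rightarrow> (int \<times> 'a) list \<Rightarrow> 'b" where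
  "insert_mu A g ws =
     (\<Sum>(us, vs, ts) \<in> {(us, vs, ts). us @ vs @ ts = ws \<and> vs \<noteq> []}.
        with_sign (sdeg us) (shifted g (us @ (sdeg vs + 2, shifted (mu A) vs) # ts)))"

definition ainf_algebra :: "('k::comm_ring_1, 'a::ab_group_add) graded_ops \<Rightarrow> bool" where
  "ainf_algebra A \<longleftrightarrow>
     graded_module A \<and>
     graded_multilinear A A (\<lambda>k. 2 - int k) (mu A) \<and>
     (\<forall>ws. ws \<noteq> [] \<and> homogeneous A ws \<longrightarrow> insert_mu A (mu A) ws = 0)"

definition minimal_ainf :: "('k, 'a::ab_group_add) graded_ops \<Rightarrow> bool" where
  "minimal_ainf A \<longleftrightarrow> (\<forall>d. \<forall>a \<in> part A d. mu A [a] = 0)"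

text \<open>Cohomology in degree \<open>d\<close>: cosets of the coboundaries.\<close>

definition cocycles :: "('k, 'a::ab_group_add) graded_ops \<Rightarrow> int \<Rightarrow> 'a set" where
  "cocycles A d = {a \<in> part A d. mu A [a] = 0}"

definition cohom_class :: "('k, 'a::ab_group_add) graded_ops \<Rightarrow> int \<Rightarrow> 'a \<Rightarrow> 'a set" where
  "cohom_class A d a = {a + mu A [w] | w. w \<in> part A (d - 1)}"

lemma cohom_class_minimal:
  assumes "ainf_algebra A" "minimal_ainf A"
  shows "cohom_class A d a = {a}"
proof -
  have "0 \<in> part A (d - 1)"
  proof (rule Modules.module.subspace_0)
    show "Modules.module (smul A)" "Modules.module.subspace (smul A) (part A (d - 1))"
      using assms(1) unfolding ainf_algebra_def graded_module_def by auto
  qed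
  then show ?thesis
    using assms(2) unfolding minimal_ainf_def cohom_class_def by fastforce
qed


section \<open>\<open>A\<^sub>\<infinity>\<close> quasi-isomorphisms\<close>

text \<open>
  Components \<open>f_k\<close> of degree \<open>1 - k\<close>. Their shifts have degree \<open>0\<close>, so no Koszul signs occur on the
  right-hand side, which sums over all ways to cut the inputs into nonempty consecutive blocks.
\<close>

definition ainf_morphism ::
  "('k, 'a::ab_group_add) graded_ops \<Rightarrow> ('k, 'b::ab_group_add) graded_ops \<Rightarrow> ('a list \<Rightarrow> 'b) \<Rightarrow> bool" where
  "ainf_morphism A B f \<longleftrightarrow>
     graded_multilinear A B (\<lambda>k. 1 - int k) f \<and>
     (\<forall>ws. ws \<noteq> [] \<and> homogeneous A ws \<longrightarrow>
        insert_mu A f ws =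
        (\<Sum>bs \<in> {bs. concat bs = ws \<and> [] \<notin> set bs}.
           shifted (mu B) (map (\<lambda>b. (sdeg b + 1, shifted f b)) bs)))"

definition ainf_quasi_iso ::
  "('k, 'a::ab_group_add) graded_ops \<Rightarrow> ('k, 'b::ab_group_add) graded_ops \<Rightarrow> ('a list \<Rightarrow> 'b) \<Rightarrow> bool" where
  "ainf_quasi_iso A B f \<longleftrightarrow>
     ainf_morphism A B f \<and>
     (\<forall>d. \<forall>a \<in> cocycles A d. \<forall>a' \<in> cocycles A d.
        cohom_class B d (f [a]) = cohom_class B d (f [a']) \<longrightarrow>
        cohom_class A d a = cohom_class A d a') \<and>
     (\<forall>d. \<forall>b \<in> cocycles B d. \<exists>a \<in> cocycles A d. cohom_class B d (f [a]) = cohom_class B d b)"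


section \<open>Massey products\<close>

text \<open>
  For a strictly increasing list \<open>js = [j\<^sub>1, ..., j\<^sub>r]\<close> with \<open>i \<le> j\<^sub>1\<close>, the list of the index pairs
  \<open>(i, j\<^sub>1), (j\<^sub>1 + 1, j\<^sub>2), ..., (j\<^bsub>r-1\<^esub> + 1, j\<^sub>r)\<close>.
\<close>

definition blocks :: "nat \<Rightarrow> nat list \<Rightarrow> (nat \<times> nat) list" where
  "blocks i js = zip (i # map Suc (butlast js)) js"

text \<open>
  The entries \<open>ws\<close> are pairs (degree, element), numbered \<open>1, ..., n\<close>. The unshifted degree required
  of \<open>x i j\<close> is one more than the sum of the shifted degrees of the entries \<open>i, ..., j\<close>.
\<close>

definition massey_deg :: "(int \<times> 'a) list \<Rightarrow> nat \<Rightarrow> nat \<Rightarrow> int" where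
  "massey_deg ws i j = 1 + (\<Sum>t = i..j. fst (ws ! (t - 1)) - 1)"

definition massey_sum ::
  "('k, 'a::ab_group_add) graded_ops \<Rightarrow> (int \<times> 'a) list \<Rightarrow> (nat \<Rightarrow> nat \<Rightarrow> 'a) \<Rightarrow> nat \<Rightarrow> nat \<Rightarrow> 'a" where
  "massey_sum A ws x i j =
     (\<Sum>js \<in> {js. length js \<ge> 2 \<and> sorted_wrt (<) js \<and> i \<le> hd js \<and> last js = j}.
        shifted (mu A) (map (\<lambda>(a, b). (massey_deg ws a b, x a b)) (blocks i js)))"

definition defining_system ::
  "('k, 'a::ab_group_add) graded_ops \<Rightarrow> (int \<times> 'a) list \<Rightarrow> (nat \<Rightarrow> nat \<Rightarrow> 'a) \<Rightarrow> bool" where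
  "defining_system A ws x \<longleftrightarrow>
     (\<forall>i \<in> {1..length ws}. x i i = snd (ws ! (i - 1))) \<and>
     (\<forall>i j. 1 \<le> i \<and> i \<le> j \<and> j \<le> length ws \<and> (i, j) \<noteq> (1, length ws) \<longrightarrow>
        x i j \<in> part A (massey_deg ws i j) \<and> mu A [x i j] = - massey_sum A ws x i j)"

definition massey_product ::
  "('k, 'a::ab_group_add) graded_ops \<Rightarrow> (int \<times> 'a) list \<Rightarrow> 'a set set" where
  "massey_product A ws =
     {cohom_class A (massey_deg ws 1 (length ws) + 1) (massey_sum A ws x 1 (length ws)) | x.
        defining_system A ws x}"

definition massey_trivial ::
  "('k, 'a::ab_group_add) graded_ops \<Rightarrow> (int \<times> 'a) list \<Rightarrow> bool" where
  "massey_trivial A ws \<longleftrightarrow>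
     massey_product A ws = {} \<or>
     cohom_class A (massey_deg ws 1 (length ws) + 1) 0 \<in> massey_product A ws"


section \<open>Singular cochain algebras\<close>

text \<open>
  A cochain assigns to a dimension \<open>n\<close> and a singular \<open>n\<close>-simplex a coefficient. All homogeneous
  cochains live in one type; the cochains of degree \<open>d\<close> are those supported in dimension \<open>d\<close>.
\<close>

type_synonym ('k, 'x) cochain = "nat \<Rightarrow> ((nat \<Rightarrow> real) \<Rightarrow> 'x) \<Rightarrow> 'k"

definition coboundary :: "'x topology \<Rightarrow> ('k::comm_ring_1, 'x) cochain \<Rightarrow> ('k, 'x) cochain" where
  "coboundary X \<phi> n \<sigma> =
     (if n \<ge> 1 \<and> singular_simplex n X \<sigma>
      then \<Sum>k\<le>n. (- 1) ^ k * \<phi> (n - 1) (singular_face n k \<sigma>) else 0)"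

definition front_face :: "nat \<Rightarrow> ((nat \<Rightarrow> real) \<Rightarrow> 'x) \<Rightarrow> (nat \<Rightarrow> real) \<Rightarrow> 'x" where
  "front_face m \<sigma> = restrict \<sigma> (standard_simplex m)"

definition back_face :: "nat \<Rightarrow> nat \<Rightarrow> ((nat \<Rightarrow> real) \<Rightarrow> 'x) \<Rightarrow> (nat \<Rightarrow> real) \<Rightarrow> 'x" where
  "back_face m l \<sigma> =
     restrict (\<lambda>t. \<sigma> (\<lambda>i. if i < m then 0 else t (i - m))) (standard_simplex l)"

definition cup ::
  "'x topology \<Rightarrow> ('k::comm_ring_1, 'x) cochain \<Rightarrow> ('k, 'x) cochain \<Rightarrow> ('k, 'x) cochain" where
  "cup X \<phi> \<psi> n \<sigma> =
     (if singular_simplex n X \<sigma>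
      then \<Sum>m\<le>n. \<phi> m (front_face m \<sigma>) * \<psi> (n - m) (back_face m (n - m) \<sigma>) else 0)"

definition cochain_algebra :: "'x topology \<Rightarrow> ('k::comm_ring_1, ('k, 'x) cochain) graded_ops" where
  "cochain_algebra X =
     \<lparr>smul = (\<lambda>r \<phi> n \<sigma>. r * \<phi> n \<sigma>),
      part = (\<lambda>d. {\<phi>. \<forall>n \<sigma>. \<phi> n \<sigma> \<noteq> 0 \<longrightarrow> int n = d \<and> singular_simplex n X \<sigma>}),
      mu = (\<lambda>\<phi>s. case \<phi>s of [\<phi>] \<Rightarrow> coboundary X \<phi> | [\<phi>, \<psi>] \<Rightarrow> cup X \<phi> \<psi> | _ \<Rightarrow> 0)\<rparr>"


section \<open>Lens spaces\<close>

definition sphere3 :: "(complex \<times> complex) set" where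
  "sphere3 = {(u, v). (cmod u)\<^sup>2 + (cmod v)\<^sup>2 = 1}"

definition lens_orbit :: "nat \<Rightarrow> nat \<Rightarrow> complex \<times> complex \<Rightarrow> (complex \<times> complex) set" where
  "lens_orbit p q w =
     {(cis (2 * pi * real k / real p) * fst w, cis (2 * pi * real (k * q) / real p) * snd w) | k :: nat. k < p}"

text \<open>The quotient topology on the set of orbits.\<close>

definition lens_space :: "nat \<Rightarrow> nat \<Rightarrow> (complex \<times> complex) set topology" where
  "lens_space p q =
     topology (\<lambda>U. U \<subseteq> lens_orbit p q ` sphere3 \<and>
       openin (top_of_set sphere3) {w \<in> sphere3. lens_orbit p q w \<in> U})"

lemma openin_lens_space:
  "openin (lens_space p q) U \<longleftrightarrow>
     U \<subseteq> lens_orbit p q ` sphere3 \<and>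
     openin (top_of_set sphere3) {w \<in> sphere3. lens_orbit p q w \<in> U}"
proof -
  let ?S = "\<lambda>U. {w \<in> sphere3. lens_orbit p q w \<in> U}"
  have "istopology (\<lambda>U. U \<subseteq> lens_orbit p q ` sphere3 \<and> openin (top_of_set sphere3) (?S U))"
    unfolding istopology_def
  proof (intro conjI allI impI)
    fix U V assume *: "U \<subseteq> lens_orbit p q ` sphere3 \<and> openin (top_of_set sphere3) (?S U)"
      "V \<subseteq> lens_orbit p q ` sphere3 \<and> openin (top_of_set sphere3) (?S V)"
    have "?S (U \<inter> V) = ?S U \<inter> ?S V" by auto
    moreover have "openin (top_of_set sphere3) (?S U \<inter> ?S V)"
      using * by (intro openin_Int) blast+
    ultimately show "openin (top_of_set sphere3) (?S (U \<inter> V))" by (rule ssubst)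
    from * show "U \<inter> V \<subseteq> lens_orbit p q ` sphere3" by auto
  next
    fix \<U> assume *: "\<forall>U\<in>\<U>. U \<subseteq> lens_orbit p q ` sphere3 \<and> openin (top_of_set sphere3) (?S U)"
    have "?S (\<Union>\<U>) = (\<Union>U\<in>\<U>. ?S U)" by auto
    moreover have "openin (top_of_set sphere3) (\<Union>U\<in>\<U>. ?S U)"
      using * by (intro openin_Union) blast
    ultimately show "openin (top_of_set sphere3) (?S (\<Union>\<U>))" by (rule ssubst)
    from * show "\<Union>\<U> \<subseteq> lens_orbit p q ` sphere3" by auto
  qed
  then show ?thesis unfolding lens_space_def by simp
qed

lemma quotient_map_lens_orbit: "quotient_map (top_of_set sphere3) (lens_space p q) (lens_orbit p q)"
proof -
  have "{w \<in> sphere3. lens_orbit p q w \<in> lens_orbit p q ` sphere3} = sphere3" by blast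
  then have "openin (lens_space p q) (lens_orbit p q ` sphere3)"
    unfolding openin_lens_space by simp
  then have "topspace (lens_space p q) = lens_orbit p q ` sphere3"
    using openin_lens_space[of p q "topspace (lens_space p q)"]
    by (intro equalityI openin_subset) simp_all
  then show ?thesis
    unfolding quotient_map_def by (auto simp: openin_lens_space)
qed


section \<open>The minimal model of a lens space\<close>

text \<open>
  Coefficients are \<open>'p mod_ring\<close>, i.e. \<open>\<int>/p\<int>\<close> for the prime \<open>p = CARD('p)\<close>. The quasi-isomorphism
  identifies \<open>M\<close>, which is its own cohomology, with the cohomology of \<open>L(p, q)\<close>.
\<close>

definition lens_minimal_model ::
  "nat \<Rightarrow> ('p::prime_card mod_ring, 'a::ab_group_add) graded_ops \<Rightarrow> 'a \<Rightarrow> 'a \<Rightarrow> 'a \<Rightarrow> 'a \<Rightarrow> bool" where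
  "lens_minimal_model q M e x y z \<longleftrightarrow>
     ainf_algebra M \<and> minimal_ainf M \<and>
     (\<exists>f. ainf_quasi_iso M
        (cochain_algebra (lens_space CARD('p) q) ::
          ('p mod_ring, ('p mod_ring, (complex \<times> complex) set) cochain) graded_ops) f) \<and>
     distinct [e, x, y, z] \<and> \<not> Modules.module.dependent (smul M) {e, x, y, z} \<and>
     (\<forall>d. part M d = Modules.module.span (smul M)
            {b. (d, b) \<in> {(0, e), (1, x), (2, y), (3, z)}}) \<and>
     mu M [e, e] = e \<and>
     (\<forall>w \<in> {x, y, z}. mu M [e, w] = w \<and> mu M [w, e] = w) \<and>
     mu M [x, y] = z \<and> mu M [y, x] = z \<and>
     mu M (replicate CARD('p) x) = y \<and>
     (\<forall>ws. ws \<noteq> [] \<and> set ws \<subseteq> {e, x, y, z} \<and>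
        ws \<notin> {[e, e], [e, x], [x, e], [e, y], [y, e], [e, z], [z, e], [x, y], [y, x],
               replicate CARD('p) x} \<longrightarrow> mu M ws = 0)"

end

theory Submission
  imports Defs
begin

text \<open>
  Every entry of a defining system has degree \<open>1\<close>, so it is a multiple of \<open>x\<close>. On multiples of \<open>x\<close>
  no operation of fewer than \<open>p\<close> arguments is non-zero; hence all obstructions vanish, and of the
  sum defining the product only \<open>\<mu>\<^sub>p(c x, \<dots>, c x) = c\<^sup>p y\<close> remains, which involves diagonal
  entries alone. All shifted degrees are \<open>0\<close>, so there are no signs, and \<open>c\<^sup>p = c\<close> by Fermat.
\<close>

section \<open>Fermat's little theorem for finite fields\<close>

text \<open>Multiplication by a nonzero \<open>a\<close> permutes the nonzero elements, so
  multiplying each of them by \<open>a\<close> leaves their product unchanged; cancelling that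
  product gives exponent \<open>card ?U\<close>, one less than the order of the field.\<close>

lemma finite_field_power_card:
  fixes a :: "'k :: {field, finite}"
  shows "a ^ CARD('k) = a"
proof (cases "a = 0")
  case False
  let ?U = "UNIV - {0 :: 'k}"
  have card: "CARD('k) = Suc (card ?U)"
    by (subst card_Suc_Diff1) auto
  have "bij_betw ((*) a) ?U ?U"
    by (rule bij_betw_byWitness[where f' = "(*) (inverse a)"])
      (use False in \<open>auto simp flip: mult.assoc\<close>)
  then have "(\<Prod>v\<in>?U. a * v) = \<Prod>?U"
    using prod.reindex_bij_betw[of "(*) a" ?U ?U "\<lambda>v. v"] by simp
  then have "a ^ card ?U * \<Prod>?U = \<Prod>?U"
    by (simp only: prod.distrib prod_constant)
  moreover have "\<Prod>?U \<noteq> 0" by (simp add: prod_zero_iff)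
  ultimately have "a ^ card ?U = 1" by (metis mult_cancel_right1)
  then show ?thesis unfolding card power_Suc by (metis mult_1_right)
qed (simp add: zero_power)

section \<open>Multilinearity and signs\<close>

text \<open>Scalars are pulled out from left to right. The prefix \<open>us\<close> collects the
  arguments already freed of their scalars, so it has to vary in the induction;
  \<open>scaled\<close> keeps the remaining tail homogeneous, as multilinearity requires.\<close>

lemma graded_multilinear_scaled:
  assumes "graded_multilinear A B D g" and "Modules.module (smul B)"
    and "x \<in> part A d" and scaled: "\<And>r. smul A r x \<in> part A d" and "homogeneous A us"
  shows "g (map snd us @ map (\<lambda>r. smul A r x) rs)
    = smul B (prod_list rs) (g (map snd us @ replicate (length rs) x))"
  using assms(5)
proof (induction rs arbitrary: us)
  case Nil
  then show ?case using assms(2) by (simp add: module.scale_one)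
next
  case (Cons r rs)
  have hom: "homogeneous A (map (\<lambda>r. (d, smul A r x)) rs)"
    using scaled by (auto simp: homogeneous_def)
  have "g (map snd us @ map (\<lambda>r. smul A r x) (r # rs))
      = smul B r (g (map snd us @ x # map (\<lambda>r. smul A r x) rs))"
  proof -
    have "\<forall>us vs d a r. homogeneous A us \<and> homogeneous A vs \<and> a \<in> part A d \<longrightarrow>
        g (map snd us @ smul A r a # map snd vs) = smul B r (g (map snd us @ a # map snd vs))"
      using assms(1) unfolding graded_multilinear_def by (elim conjE)
    from this[rule_format, of us "map (\<lambda>r. (d, smul A r x)) rs" x d r]
    show ?thesis using Cons.prems hom assms(3) by (simp add: comp_def)
  qed
  also have "g (map snd us @ x # map (\<lambda>r. smul A r x) rs)
      = smul B (prod_list rs) (g (map snd us @ replicate (length (r # rs)) x))"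
    using Cons.IH[of "us @ [(d, x)]"] Cons.prems assms(3) by (auto simp: homogeneous_def)
  finally show ?case using assms(2) by (simp add: module.scale_scale)
qed

text \<open>Each factor \<open>fst (ws ! i) - 1\<close> is 0, so the exponent of the sign
  vanishes.\<close>

lemma shifted_degree_one:
  assumes "\<And>w. w \<in> set ws \<Longrightarrow> fst w = 1"
  shows "shifted g ws = g (map snd ws)"
proof -
  have "fst (ws ! i) = 1" if "i < length ws" for i
    using assms that by simp
  then show ?thesis by (simp add: shifted_def with_sign_def)
qed

lemma massey_deg_replicate_one:
  assumes "1 \<le> i" "j \<le> n"
  shows "massey_deg (replicate n (1, a)) i j = 1"
  using assms unfolding massey_deg_def by (auto intro!: sum.neutral)

section \<open>Strictly increasing lists of block ends\<close>

lemma strict_sorted_set_subset: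
  fixes js :: "nat list"
  assumes "sorted_wrt (<) js" "js \<noteq> []" "i \<le> hd js" "last js = j"
  shows "set js \<subseteq> {i..j}"
proof
  fix t assume "t \<in> set js"
  then obtain k where k: "k < length js" "t = js ! k" by (auto simp: in_set_conv_nth)
  have mono: "js ! a \<le> js ! b" if "a \<le> b" "b < length js" for a b
    using assms(1) that by (cases "a = b") (auto simp: sorted_wrt_iff_nth_less less_imp_le)
  have "js ! 0 \<le> t" "t \<le> js ! (length js - 1)"
    using k mono[of 0 k] mono[of k "length js - 1"] by auto
  then show "t \<in> {i..j}"
    using assms by (auto simp: hd_conv_nth last_conv_nth)
qed

text \<open>Bounds the arity of the operations that can occur in \<open>massey_sum\<close> at
  \<open>(i, j)\<close>: a strictly increasing list has no repetitions, so its length is the size of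
  a subset of \<open>{i..j}\<close>.\<close>

lemma strict_sorted_length_le:
  fixes js :: "nat list"
  assumes "sorted_wrt (<) js" "js \<noteq> []" "i \<le> hd js" "last js = j"
  shows "length js \<le> Suc j - i"
proof -
  have "length js = card (set js)"
    using assms(1) by (simp add: distinct_card strict_sorted_iff)
  also have "\<dots> \<le> card {i..j}"
    by (rule card_mono) (use strict_sorted_set_subset[OF assms] in auto)
  finally show ?thesis by simp
qed

text \<open>The equality case: the entries then exhaust \<open>{i..j}\<close>, and a strictly
  increasing list is determined by its set.\<close>

lemma strict_sorted_full_length:
  fixes js :: "nat list"
  assumes "sorted_wrt (<) js" "js \<noteq> []" "i \<le> hd js" "last js = j" "length js = Suc j - i"
  shows "js = [i..<Suc j]"
proof -
  have "card (set js) = card {i..j}"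
    using assms(1,5) by (simp add: distinct_card strict_sorted_iff)
  then have "set js = {i..j}"
    using strict_sorted_set_subset[OF assms(1-4)] by (intro card_subset_eq) auto
  moreover have "{i..j} = set [i..<Suc j]" by auto
  ultimately show ?thesis
    using assms(1) by (metis strict_sorted_equal sorted_wrt_upt)
qed

text \<open>With at least two blocks each one is a proper subinterval, so \<open>massey_sum\<close>
  at \<open>(1, n)\<close> never reads the entry \<open>(1, n)\<close>, about which a defining
  system says nothing.\<close>

lemma blocks_bounds:
  assumes "sorted_wrt (<) js" "length js \<ge> 2" "i \<le> hd js" "last js = j"
    and "(a, b) \<in> set (blocks i js)"
  shows "i \<le> a" "a \<le> b" "b \<le> j" "(a, b) \<noteq> (i, j)"
proof -
  obtain k where k: "k < length js" "a = (i # map Suc (butlast js)) ! k" "b = js ! k"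
    using assms(5) by (auto simp: blocks_def in_set_zip)
  have "set js \<subseteq> {i..j}"
    using assms by (intro strict_sorted_set_subset) auto
  then have sub: "js ! l \<in> {i..j}" if "l < length js" for l
    using that nth_mem by blast
  then show "b \<le> j" using k(1,3) by simp
  \<comment> \<open>Only the last block ends at \<open>j\<close>; this excludes
    \<open>(i, j)\<close> as the first block.\<close>
  have less: "js ! a \<noteq> j" if "a < length js - 1" for a
    using sorted_wrt_nth_less[OF assms(1), of a "length js - 1"] that assms(2,4)
    by (cases "js = []") (auto simp: last_conv_nth)
  have "i \<le> a \<and> a \<le> b \<and> (a, b) \<noteq> (i, j)"
  proof (cases k)
    case 0
    then show ?thesis
      using k assms(2,3) less[of 0] by (cases "js = []") (auto simp: hd_conv_nth)
  next
    \<comment> \<open>A later block starts just after an earlier end, which is at least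
      \<open>i\<close>, hence strictly beyond \<open>i\<close>.\<close>
    case (Suc l)
    then have "a = Suc (js ! l)" "js ! l < js ! Suc l"
      using k assms(1) by (auto simp: nth_butlast sorted_wrt_iff_nth_less)
    moreover have "js ! l \<ge> i" using sub[of l] k(1) Suc by simp
    ultimately show ?thesis using k Suc by auto
  qed
  then show "i \<le> a" "a \<le> b" "(a, b) \<noteq> (i, j)" by auto
qed

lemma blocks_upt: "blocks i [i..<j] = map (\<lambda>k. (k, k)) [i..<j]"
proof (rule nth_equalityI)
  show "length (blocks i [i..<j]) = length (map (\<lambda>k. (k, k)) [i..<j])"
    by (cases "i < j") (auto simp: blocks_def)
next
  fix k assume "k < length (blocks i [i..<j])"
  then have k: "k < j - i" by (simp add: blocks_def)
  then have "(i # map Suc (butlast [i..<j])) ! k = i + k"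
    by (cases k) (simp_all add: nth_butlast)
  with k show "blocks i [i..<j] ! k = map (\<lambda>k. (k, k)) [i..<j] ! k"
    by (simp add: blocks_def)
qed

text \<open>Allows a single summand to be split off \<open>massey_sum\<close>; over an infinite
  index set \<open>sum\<close> would be 0 by default.\<close>

lemma finite_massey_index:
  "finite {js :: nat list. length js \<ge> 2 \<and> sorted_wrt (<) js \<and> i \<le> hd js \<and> last js = j}"
proof (rule finite_subset)
  show "{js. length js \<ge> 2 \<and> sorted_wrt (<) js \<and> i \<le> hd js \<and> last js = j}
      \<subseteq> {js. set js \<subseteq> {i..j} \<and> length js \<le> Suc j - i}"
  proof clarify
    fix js :: "nat list"
    assume "length js \<ge> 2" "sorted_wrt (<) js" "i \<le> hd js"
    moreover from this have "js \<noteq> []" by auto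
    ultimately show "set js \<subseteq> {i..last js} \<and> length js \<le> Suc (last js) - i"
      using strict_sorted_set_subset[of js i] strict_sorted_length_le[of js i] by blast
  qed
  show "finite {js. set js \<subseteq> {i..j} \<and> length js \<le> Suc j - i}"
    by (rule finite_lists_length_le) simp
qed

section \<open>Evaluation of the Massey sums\<close>

text \<open>\<open>X\<close> is only assumed to take values in the multiples of \<open>x\<close>,
  not to be a defining system. The formula can therefore both verify the equations of a candidate
  system and evaluate the product on an arbitrary one. The element \<open>u\<close> is arbitrary
  because \<open>massey_deg\<close> reads only degrees.\<close>

lemma massey_sum_replicate:
  assumes lin: "graded_multilinear A A D (mu A)" and mod: "Modules.module (smul A)"
    and x: "x \<in> part A d" and scaled: "\<And>r. smul A r x \<in> part A d"
    and zero: "\<And>r. 2 \<le> r \<Longrightarrow> r < n \<Longrightarrow> mu A (replicate r x) = 0"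
    and X: "\<And>a b. i \<le> a \<Longrightarrow> a \<le> b \<Longrightarrow> b \<le> j \<Longrightarrow> (a, b) \<noteq> (i, j) \<Longrightarrow> X a b \<in> range (\<lambda>r. smul A r x)"
    and diag: "\<And>a. i \<le> a \<Longrightarrow> a \<le> j \<Longrightarrow> X a a = smul A c x"
    and bounds: "1 \<le> i" "j \<le> n" "2 \<le> n"
  shows "massey_sum A (replicate n (1, u)) X i j
    = (if i = 1 \<and> j = n then smul A (c ^ n) (mu A (replicate n x)) else 0)"
proof -
  let ?J = "{js. length js \<ge> 2 \<and> sorted_wrt (<) js \<and> i \<le> hd js \<and> last js = j}"
  let ?t = "\<lambda>js. shifted (mu A) (map (\<lambda>(a, b). (massey_deg (replicate n (1, u)) a b, X a b)) (blocks i js))"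
  have scaled_mu: "mu A (map (\<lambda>r. smul A r x) rs) = smul A (prod_list rs) (mu A (replicate (length rs) x))"
    for rs
    using graded_multilinear_scaled[OF lin mod x scaled, of "[]" rs] by (simp add: homogeneous_def)
  have entry: "?t js = mu A (map (\<lambda>(a, b). X a b) (blocks i js))" if "js \<in> ?J" for js
  proof -
    have "?t js = mu A (map snd (map (\<lambda>(a, b). (massey_deg (replicate n (1, u)) a b, X a b)) (blocks i js)))"
    proof (rule shifted_degree_one)
      fix w assume "w \<in> set (map (\<lambda>(a, b). (massey_deg (replicate n (1, u)) a b, X a b)) (blocks i js))"
      then obtain a b where ab: "(a, b) \<in> set (blocks i js)"
        "w = (massey_deg (replicate n (1, u)) a b, X a b)" by auto
      have "1 \<le> a" "b \<le> n"
        using blocks_bounds[of js i j a b] that ab(1) bounds by auto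
      then show "fst w = 1" using ab(2) massey_deg_replicate_one by auto
    qed
    then show ?thesis by (simp add: case_prod_unfold comp_def)
  qed
  have short: "?t js = 0" if js: "js \<in> ?J" and "length js < n" for js
  proof -
    \<comment> \<open>Any choice of coefficients will do: their product multiplies
      \<open>mu A (replicate (length js) x)\<close>, which is 0.\<close>
    define r where "r = (\<lambda>(a, b). SOME r. X a b = smul A r x)"
    have "X a b = smul A (r (a, b)) x" if "(a, b) \<in> set (blocks i js)" for a b
    proof -
      have "X a b \<in> range (\<lambda>r. smul A r x)"
        using blocks_bounds[of js i j a b] js that by (intro X) auto
      then show ?thesis unfolding r_def by (auto intro: someI)
    qed
    then have entries: "map (\<lambda>(a, b). X a b) (blocks i js) = map (\<lambda>r. smul A r x) (map r (blocks i js))"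
      by auto
    have "length (blocks i js) = length js"
      using js by (auto simp: blocks_def)
    then have "?t js = smul A (prod_list (map r (blocks i js))) (mu A (replicate (length js) x))"
      unfolding entry[OF js] entries scaled_mu by simp
    also have "\<dots> = 0"
      using zero[of "length js"] js that(2) mod by (simp add: module.scale_zero_right)
    finally show ?thesis .
  qed
  have len: "length js \<le> Suc j - i" if "js \<in> ?J" for js
    using strict_sorted_length_le[of js i j] that by force
  show ?thesis
  proof (cases "i = 1 \<and> j = n")
    case False
    \<comment> \<open>Away from \<open>(1, n)\<close> the interval has fewer than \<open>n\<close>
      points, so every list is short.\<close>
    have "?t js = 0" if "js \<in> ?J" for js
      using short[OF that] len[OF that] False bounds by auto
    then show ?thesis unfolding massey_sum_def if_not_P[OF False] by (intro sum.neutral) blast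
  next
    case True
    \<comment> \<open>The cut into singletons, the only one of length \<open>n\<close>.\<close>
    let ?full = "[i..<Suc j]"
    have full: "?full \<in> ?J"
      using True bounds by (auto simp del: upt_Suc simp: last_conv_nth)
    have "?t js = 0" if "js \<in> ?J - {?full}" for js
    proof (rule short)
      show "js \<in> ?J" using that by blast
      have "length js \<noteq> n"
        using strict_sorted_full_length[of js i j] that True bounds by force
      then show "length js < n" using len[of js] that True by auto
    qed
    then have "massey_sum A (replicate n (1, u)) X i j = ?t ?full"
      unfolding massey_sum_def
      by (subst sum.remove[OF finite_massey_index full]) (simp add: sum.neutral)
    also have "\<dots> = mu A (map (\<lambda>(a, b). X a b) (blocks i ?full))"
      by (rule entry[OF full])
    also have "map (\<lambda>(a, b). X a b) (blocks i ?full) = map (\<lambda>r. smul A r x) (replicate n c)"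
      unfolding blocks_upt using True diag
      by (intro nth_equalityI) (auto simp del: upt_Suc)
    also have "mu A \<dots> = smul A (c ^ n) (mu A (replicate n x))"
      by (subst scaled_mu) simp
    finally show ?thesis using True by simp
  qed
qed

section \<open>The Massey product in the minimal model\<close>

theorem theorem2p22:
  fixes M :: "('p::prime_card mod_ring, 'a::ab_group_add) graded_ops"
    and e x y z :: 'a
    and p q :: nat
  assumes "p = CARD('p)" and "p \<noteq> 2" and "1 \<le> q" and "q < p"
    and "lens_minimal_model q M e x y z"
  shows "\<forall>c :: 'p mod_ring. c \<noteq> 0 \<longrightarrow>
           massey_product M (replicate p (1, smul M c x)) = {cohom_class M 2 (smul M c y)} \<and>
           \<not> massey_trivial M (replicate p (1, smul M c x))"
proof (intro allI impI)
  fix c :: "'p mod_ring" assume "c \<noteq> 0"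
  let ?ws = "replicate p (1 :: int, smul M c x)"
  have p: "2 \<le> p"
    using assms(1) prime_card[where 'a = 'p] prime_ge_2_nat by auto
  have alg: "ainf_algebra M" and min: "minimal_ainf M" and dist: "distinct [e, x, y, z]"
    and indep: "\<not> Modules.module.dependent (smul M) {e, x, y, z}"
    and "part M 1 = Modules.module.span (smul M) {b. (1, b) \<in> {(0, e), (1, x), (2, y), (3 :: int, z)}}"
    and top: "mu M (replicate p x) = y"
    and other: "\<And>ws. ws \<noteq> [] \<Longrightarrow> set ws \<subseteq> {e, x, y, z} \<Longrightarrow>
        ws \<notin> {[e, e], [e, x], [x, e], [e, y], [y, e], [e, z], [z, e], [x, y], [y, x], replicate p x}
        \<Longrightarrow> mu M ws = 0"
    using assms(1,5) unfolding lens_minimal_model_def by auto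
  moreover have "{b. (1, b) \<in> {(0, e), (1, x), (2, y), (3 :: int, z)}} = {x}" by auto
  moreover have mod: "Modules.module (smul M)" and lin: "graded_multilinear M M (\<lambda>k. 2 - int k) (mu M)"
    using alg unfolding ainf_algebra_def graded_module_def by auto
  ultimately have part1: "part M 1 = range (\<lambda>r. smul M r x)"
    using module.span_singleton by metis
  then have x1: "x \<in> part M 1" and scaled: "\<And>r. smul M r x \<in> part M 1"
    using module.scale_one[OF mod] by (auto intro: range_eqI[of _ _ 1])
  have zero: "mu M (replicate r x) = 0" if "2 \<le> r" "r < p" for r
  proof (rule other)
    show "replicate r x \<noteq> []" using that by auto
    show "set (replicate r x) \<subseteq> {e, x, y, z}" by auto
    have "replicate r x \<noteq> replicate p x"
      using that by (metis length_replicate nat_neq_iff)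
    \<comment> \<open>Every exceptional pair in the multiplication table contains a generator other
      than \<open>x\<close>.\<close>
    moreover have "v = x \<and> w = x" if "replicate r x = [v, w]" for v w
    proof -
      have "set [v, w] \<subseteq> {x}" unfolding that[symmetric] by auto
      then show ?thesis by simp
    qed
    ultimately show "replicate r x \<notin> {[e, e], [e, x], [x, e], [e, y], [y, e], [e, z], [z, e], [x, y],
        [y, x], replicate p x}"
      using dist by auto
  qed
  have sum: "massey_sum M ?ws X i j = (if i = 1 \<and> j = p then smul M c y else 0)"
    if deg_one: "\<And>a b. 1 \<le> a \<Longrightarrow> a \<le> b \<Longrightarrow> b \<le> p \<Longrightarrow> (a, b) \<noteq> (1, p) \<Longrightarrow> X a b \<in> part M 1"
      and "\<And>a. 1 \<le> a \<Longrightarrow> a \<le> p \<Longrightarrow> X a a = smul M c x" and "1 \<le> i" "j \<le> p" for X i j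
  proof -
    have "c ^ p = c"
      using finite_field_power_card[of c] assms(1) by simp
    moreover have "X a b \<in> range (\<lambda>r. smul M r x)"
      if "i \<le> a" "a \<le> b" "b \<le> j" "(a, b) \<noteq> (i, j)" for a b
      \<comment> \<open>A proper subinterval of \<open>{i..j}\<close> cannot be all of
        \<open>{1..p}\<close>, so \<open>deg_one\<close> applies.\<close>
      using deg_one[of a b] that \<open>1 \<le> i\<close> \<open>j \<le> p\<close> part1 by auto
    ultimately show ?thesis
      using massey_sum_replicate[OF lin mod x1 scaled zero, of p i j X c "smul M c x"] that p top
      by simp
  qed
  \<comment> \<open>By minimality there are no nonzero coboundaries, so classes can be compared as
    elements, whatever the degree \<open>d\<close>.\<close>
  have coset: "cohom_class M d a = {a}" for d a
    using alg min by (rule cohom_class_minimal)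
  have deg: "massey_deg ?ws i j = 1" if "1 \<le> i" "j \<le> p" for i j
    using that by (rule massey_deg_replicate_one)
  have "mu M [smul M c x] = 0"
    using min scaled unfolding minimal_ainf_def by blast
  \<comment> \<open>The constant family is the witness for nonemptiness: both sides of each equation
    vanish, the left by minimality and the right by \<open>sum\<close>.\<close>
  then have system: "defining_system M ?ws (\<lambda>i j. smul M c x)"
    unfolding defining_system_def
    using sum[of "\<lambda>i j. smul M c x"] scaled deg by auto
  have val: "massey_sum M ?ws X 1 p = smul M c y" if "defining_system M ?ws X" for X
  proof -
    have "X a b \<in> part M 1" if "1 \<le> a" "a \<le> b" "b \<le> p" "(a, b) \<noteq> (1, p)" for a b
      using \<open>defining_system M ?ws X\<close> that deg[of a b] unfolding defining_system_def
      by (metis length_replicate)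
    moreover have "X a a = smul M c x" if "1 \<le> a" "a \<le> p" for a
      using \<open>defining_system M ?ws X\<close> that unfolding defining_system_def by auto
    ultimately show ?thesis using sum[of X 1 p] p by auto
  qed
  have prod: "massey_product M ?ws = {cohom_class M 2 (smul M c y)}"
  proof (intro equalityI subsetI)
    fix C assume "C \<in> massey_product M ?ws"
    then show "C \<in> {cohom_class M 2 (smul M c y)}"
      unfolding massey_product_def coset by (auto simp: val simp del: One_nat_def)
  next
    fix C assume "C \<in> {cohom_class M 2 (smul M c y)}"
    then have "C = {massey_sum M ?ws (\<lambda>i j. smul M c x) 1 p}"
      using val[OF system] coset by simp
    then show "C \<in> massey_product M ?ws"
      unfolding massey_product_def coset length_replicate using system by blast
  qed
  \<comment> \<open>The scalar \<open>c\<close> is invertible, and \<open>y\<close> is nonzero as a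
    member of an independent set.\<close>
  have "smul M c y \<noteq> 0"
  proof
    assume "smul M c y = 0"
    then have "smul M (inverse c * c) y = 0"
      using mod by (metis module.scale_scale module.scale_zero_right)
    then have "y = 0" using \<open>c \<noteq> 0\<close> module.scale_one[OF mod, of y] by simp
    then show False using indep module.dependent_zero[OF mod, of "{e, x, y, z}"] by simp
  qed
  then have "\<not> massey_trivial M ?ws"
    unfolding massey_trivial_def prod coset by simp
  with prod show "massey_product M ?ws = {cohom_class M 2 (smul M c y)} \<and> \<not> massey_trivial M ?ws" ..
qed

end
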